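(* Consider the bivariate random coefficient (integer-autoregressive) model $$X\mid Y\;\overset{d}{=}\;\sum_{i=1}^{Y}Z_i+\epsilon,\qquad Y\mid X\;\overset{d}{=}\;\sum_{i=1}^{X}W_i+\eta,$$ where $(Z_i)$ are Bernoulli, conditionally i.i.d. given a random probability parameter $p$, and independent of $\epsilon$, and $(W_i)$ are Bernoulli, conditionally i.i.d. given a random probability parameter $q$, and independent of $\eta$; $p$ and $q$ are random between $0$ and $1$, but not necessarily independent. If the support of $(X,Y)$ is the entire space $\mathbb{N}_0^2$, then this model is compatible if and only if $p$ and $q$ both follow the beta distribution, with parameters $(\alpha,\beta_1)$ and $(\alpha,\beta_2)$, respectively, and $\epsilon$ (resp. $\eta$) follows the negative binomial distribution with number of successes parameter $\beta_2$ (resp. $\beta_1$), with common probability parameter $\theta$ between $0$ and $1$.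
   Context: $\mathbb{N}_0=\{0,1,2,\dots\}$; $\epsilon,\eta$ are count ($\mathbb{N}_0$-valued) variables and $\overset{d}{=}$ denotes equality in distribution. Explicitly, with $g,h$ the probability mass functions of $\epsilon,\eta$, the model says $$\ell(x\mid y)=\sum_{i=0}^{\min(x,y)}\binom{y}{i}\mathbb{E}[p^i(1-p)^{y-i}]\,g(x-i),\qquad \ell(y\mid x)=\sum_{i=0}^{\min(x,y)}\binom{x}{i}\mathbb{E}[q^i(1-q)^{x-i}]\,h(y-i).$$ The model is compatible if there exists a joint distribution of $(X,Y)$ with these conditional distributions. The negative binomial distribution with number of successes parameter $r$ and probability parameter $\theta$ has mass function $\frac{\Gamma(n+r)}{n!\,\Gamma(r)}\theta^r(1-\theta)^n$, $n\in\mathbb{N}_0$. The beta distribution with parameters $(a,b)$ has density proportional to $x^{a-1}(1-x)^{b-1}$ on $(0,1)$.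
   Formalization: It is additionally assumed that p and q are not both almost surely constant; otherwise the claim fails, e.g. for X=N1+N2, Y=N1+N3 with independent Poisson N1, N2, N3, which is compatible with full support but has constant p and q. *)

theory Defs
  imports "HOL-Probability.Probability"
begin

text \<open>
  Given the real random variable \<open>p\<close>, with values in the closed unit interval, the
  variables \<open>Z 0, Z 1, \<dots>\<close> are i.i.d. Bernoulli with success probability \<open>p\<close>. The conditioning
  is on the sigma-algebra generated by \<open>p\<close>, which is \<open>vimage_algebra (space M) p borel\<close>.
\<close>

definition cond_iid_bernoulli ::
    "'a measure \<Rightarrow> ('a \<Rightarrow> real) \<Rightarrow> (nat \<Rightarrow> 'a \<Rightarrow> bool) \<Rightarrow> bool" where
  "cond_iid_bernoulli M p Z \<longleftrightarrow>
     p \<in> borel_measurable M \<and>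
     (AE \<omega> in M. 0 \<le> p \<omega> \<and> p \<omega> \<le> 1) \<and>
     (\<forall>i. Z i \<in> measurable M (count_space UNIV)) \<and>
     (\<forall>n b. AE \<omega> in M.
        real_cond_exp M (vimage_algebra (space M) p borel)
          (indicator {\<omega> \<in> space M. \<forall>i<n. Z i \<omega> = b i}) \<omega>
        = (\<Prod>i<n. pmf (bernoulli_pmf (p \<omega>)) (b i)))"

text \<open>
  The sequence \<open>Z\<close> as a whole (as a random element of the product space of boolean sequences)
  is independent of \<open>\<epsilon>\<close>. Nothing is said about the joint law of \<open>p\<close> and \<open>\<epsilon>\<close>.
\<close>

definition random_coefficient_part ::
    "'a measure \<Rightarrow> ('a \<Rightarrow> real) \<Rightarrow> (nat \<Rightarrow> 'a \<Rightarrow> bool) \<Rightarrow> ('a \<Rightarrow> nat) \<Rightarrow> bool" where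
  "random_coefficient_part M p Z \<epsilon> \<longleftrightarrow>
     cond_iid_bernoulli M p Z \<and>
     \<epsilon> \<in> measurable M (count_space UNIV) \<and>
     prob_space.indep_set M
       (sets (vimage_algebra (space M) (\<lambda>\<omega> i. Z i \<omega>) (PiM UNIV (\<lambda>_. count_space UNIV))))
       (sets (vimage_algebra (space M) \<epsilon> (count_space UNIV)))"

definition thinned_sum ::
    "(nat \<Rightarrow> 'a \<Rightarrow> bool) \<Rightarrow> ('a \<Rightarrow> nat) \<Rightarrow> nat \<Rightarrow> 'a \<Rightarrow> nat" where
  "thinned_sum Z \<epsilon> y \<omega> = (\<Sum>i<y. of_bool (Z i \<omega>)) + \<epsilon> \<omega>"

text \<open>
  \<open>J\<close> is a joint law of \<open>(X, Y)\<close> for the model: given \<open>Y = y\<close>, \<open>X\<close> is distributed as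
  \<open>thinned_sum Z \<epsilon> y\<close>, and given \<open>X = x\<close>, \<open>Y\<close> is distributed as \<open>thinned_sum W \<eta> x\<close>. As usual,
  conditional laws are only constrained at values taken with positive probability.
\<close>

definition model_joint_law ::
    "'a measure \<Rightarrow> (nat \<Rightarrow> 'a \<Rightarrow> bool) \<Rightarrow> ('a \<Rightarrow> nat) \<Rightarrow> (nat \<Rightarrow> 'a \<Rightarrow> bool) \<Rightarrow> ('a \<Rightarrow> nat) \<Rightarrow>
     (nat \<times> nat) pmf \<Rightarrow> bool" where
  "model_joint_law M Z \<epsilon> W \<eta> J \<longleftrightarrow>
     (\<forall>y \<in> snd ` set_pmf J. \<forall>x.
        \<P>(v in measure_pmf J. fst v = x \<bar> snd v = y) = \<P>(\<omega> in M. thinned_sum Z \<epsilon> y \<omega> = x)) \<and>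
     (\<forall>x \<in> fst ` set_pmf J. \<forall>y.
        \<P>(v in measure_pmf J. snd v = y \<bar> fst v = x) = \<P>(\<omega> in M. thinned_sum W \<eta> x \<omega> = y))"

definition beta_density :: "real \<Rightarrow> real \<Rightarrow> real \<Rightarrow> real" where
  "beta_density a b x =
     (if 0 < x \<and> x < 1 then x powr (a - 1) * (1 - x) powr (b - 1) / Beta a b else 0)"

definition neg_binomial_mass :: "real \<Rightarrow> real \<Rightarrow> nat \<Rightarrow> real" where
  "neg_binomial_mass r \<theta> n = Gamma (real n + r) / (fact n * Gamma r) * \<theta> powr r * (1 - \<theta>) ^ n"

definition beta_distributed :: "'a measure \<Rightarrow> ('a \<Rightarrow> real) \<Rightarrow> real \<Rightarrow> real \<Rightarrow> bool" where
  "beta_distributed M p a b \<longleftrightarrow> distributed M lborel p (\<lambda>x. ennreal (beta_density a b x))"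

definition neg_binomial_distributed :: "'a measure \<Rightarrow> ('a \<Rightarrow> nat) \<Rightarrow> real \<Rightarrow> real \<Rightarrow> bool" where
  "neg_binomial_distributed M \<epsilon> r \<theta> \<longleftrightarrow>
     (\<forall>n. \<P>(\<omega> in M. \<epsilon> \<omega> = n) = neg_binomial_mass r \<theta> n)"

text \<open>
  Randomness of the coefficients: the equivalence is false when \<open>p\<close> and \<open>q\<close> are both almost
  surely constant. For example, \<open>p = q = 0\<close> makes the model compatible, with \<open>X\<close> and \<open>Y\<close>
  independent, whatever the laws of \<open>\<epsilon>\<close> and \<open>\<eta>\<close>; bivariate Poisson laws with a common
  component give examples with constants in the open interval.
\<close>

definition ae_constant :: "'a measure \<Rightarrow> ('a \<Rightarrow> real) \<Rightarrow> bool" where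
  "ae_constant M p \<longleftrightarrow> (\<exists>c. AE \<omega> in M. p \<omega> = c)"

text \<open>
  The lemma \<open>thinned_sum_prob\<close> below confirms that \<open>thinned_sum\<close> has the mass function
  \<open>x \<mapsto> (\<Sum>i\<le>min x y. (y choose i) * E[p ^ i * (1 - p) ^ (y - i)] * g (x - i))\<close>, where \<open>g\<close> is
  the mass function of \<open>\<epsilon>\<close>.
\<close>

lemma cond_iid_bernoulli_prob:
  assumes "prob_space M" "cond_iid_bernoulli M p Z"
  shows "\<P>(\<omega> in M. \<forall>i<n. Z i \<omega> = b i) = (\<integral>\<omega>. (\<Prod>i<n. if b i then p \<omega> else 1 - p \<omega>) \<partial>M)"
proof -
  interpret prob_space M by fact
  have p[measurable]: "p \<in> borel_measurable M" and Z[measurable]: "\<And>i. Z i \<in> measurable M (count_space UNIV)"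
    and p01: "AE \<omega> in M. 0 \<le> p \<omega> \<and> p \<omega> \<le> 1"
    and ce: "AE \<omega> in M. real_cond_exp M (vimage_algebra (space M) p borel)
          (indicator {\<omega> \<in> space M. \<forall>i<n. Z i \<omega> = b i}) \<omega>
        = (\<Prod>i<n. pmf (bernoulli_pmf (p \<omega>)) (b i))"
    using assms(2) unfolding cond_iid_bernoulli_def by auto
  let ?F = "vimage_algebra (space M) p borel"
  let ?A = "{\<omega> \<in> space M. \<forall>i<n. Z i \<omega> = b i}"
  have sub: "subalgebra M ?F"
    unfolding subalgebra_def using p by (auto simp: measurable_sets sets_vimage_algebra2)
  interpret finite_measure_subalgebra M ?F
    by unfold_locales (rule sub)
  have A[measurable]: "?A \<in> sets M" by measurable
  have "\<P>(\<omega> in M. \<forall>i<n. Z i \<omega> = b i) = (\<integral>\<omega>. indicator ?A \<omega> \<partial>M)" using A by simp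
  also have "\<dots> = (\<integral>\<omega>. real_cond_exp M ?F (indicator ?A) \<omega> \<partial>M)"
    by (rule real_cond_exp_int(2)[symmetric]) (use A in \<open>simp add: integrable_indicator_iff emeasure_eq_measure\<close>)
  also have "\<dots> = (\<integral>\<omega>. (\<Prod>i<n. if b i then p \<omega> else 1 - p \<omega>) \<partial>M)"
  proof (rule integral_cong_AE)
    show "AE \<omega> in M. real_cond_exp M ?F (indicator ?A) \<omega> = (\<Prod>i<n. if b i then p \<omega> else 1 - p \<omega>)"
      using ce p01 by eventually_elim (auto intro!: prod.cong)
  qed auto
  finally show ?thesis .
qed

lemma sum_cond_iid_bernoulli_prob:
  assumes "prob_space M" "cond_iid_bernoulli M p Z"
  shows "\<P>(\<omega> in M. (\<Sum>i<n. of_bool (Z i \<omega>)) = k) = real (n choose k) * (\<integral>\<omega>. p \<omega> ^ k * (1 - p \<omega>) ^ (n - k) \<partial>M)"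
proof -
  interpret prob_space M by fact
  have Z[measurable]: "\<And>i. Z i \<in> measurable M (count_space UNIV)"
    using assms(2) unfolding cond_iid_bernoulli_def by auto
  let ?S = "{B. B \<subseteq> {..<n} \<and> card B = k}"
  let ?A = "\<lambda>B. {\<omega> \<in> space M. \<forall>i<n. Z i \<omega> = (i \<in> B)}"
  have fin: "finite ?S" by simp
  have sum: "(\<Sum>i<n. of_bool (Z i \<omega>)) = card {i. i < n \<and> Z i \<omega>}" for \<omega>
    by (simp add: of_bool_def sum.If_cases Int_def)
  have eq: "{\<omega> \<in> space M. (\<Sum>i<n. of_bool (Z i \<omega>)) = k} = (\<Union>B\<in>?S. ?A B)"
  proof (intro equalityI subsetI)
    fix \<omega> assume "\<omega> \<in> {\<omega> \<in> space M. (\<Sum>i<n. of_bool (Z i \<omega>)) = k}"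
    then show "\<omega> \<in> (\<Union>B\<in>?S. ?A B)" unfolding sum
      by (auto intro!: exI[of _ "{i. i < n \<and> Z i \<omega>}"])
  next
    fix \<omega> assume "\<omega> \<in> (\<Union>B\<in>?S. ?A B)"
    then obtain B where B: "B \<subseteq> {..<n}" "card B = k" "\<omega> \<in> space M" "\<forall>i<n. Z i \<omega> = (i \<in> B)" by auto
    then have "{i. i < n \<and> Z i \<omega>} = B" by auto
    then show "\<omega> \<in> {\<omega> \<in> space M. (\<Sum>i<n. of_bool (Z i \<omega>)) = k}" using B unfolding sum by auto
  qed
  have disj: "disjoint_family_on ?A ?S"
    unfolding disjoint_family_on_def
  proof (intro ballI impI)
    fix B C assume "B \<in> ?S" "C \<in> ?S" "B \<noteq> C"
    then obtain i where "i < n" "(i \<in> B) \<noteq> (i \<in> C)" by auto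
    then show "?A B \<inter> ?A C = {}" by auto
  qed
  have "\<P>(\<omega> in M. (\<Sum>i<n. of_bool (Z i \<omega>)) = k) = (\<Sum>B\<in>?S. prob (?A B))"
    unfolding eq by (rule finite_measure_finite_Union[OF fin _ disj]) auto
  also have "\<dots> = (\<Sum>B\<in>?S. \<integral>\<omega>. p \<omega> ^ k * (1 - p \<omega>) ^ (n - k) \<partial>M)"
  proof (rule sum.cong[OF refl])
    fix B assume B: "B \<in> ?S"
    then have *: "{..<n} \<inter> {x. x \<in> B} = B" "{..<n} \<inter> - {x. x \<in> B} = {..<n} - B" by auto
    have c: "card ({..<n} - B) = n - k" using B by (subst card_Diff_subset) (auto intro: finite_subset)
    have "(\<Prod>i<n. if i \<in> B then p \<omega> else 1 - p \<omega>) = p \<omega> ^ k * (1 - p \<omega>) ^ (n - k)" for \<omega>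
      using B c by (simp add: prod.If_cases *[simplified] * flip: Diff_eq)
    then show "prob (?A B) = (\<integral>\<omega>. p \<omega> ^ k * (1 - p \<omega>) ^ (n - k) \<partial>M)"
      using cond_iid_bernoulli_prob[OF assms, of n "\<lambda>i. i \<in> B"] by simp
  qed
  also have "\<dots> = real (n choose k) * (\<integral>\<omega>. p \<omega> ^ k * (1 - p \<omega>) ^ (n - k) \<partial>M)"
    using n_subsets[of "{..<n}" k] by simp
  finally show ?thesis .
qed

lemma thinned_sum_prob:
  assumes "prob_space M" and mod: "random_coefficient_part M p Z \<epsilon>"
  shows "\<P>(\<omega> in M. thinned_sum Z \<epsilon> y \<omega> = x) =
    (\<Sum>i\<le>min x y. real (y choose i) * (\<integral>\<omega>. p \<omega> ^ i * (1 - p \<omega>) ^ (y - i) \<partial>M) * \<P>(\<omega> in M. \<epsilon> \<omega> = x - i))"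
proof -
  interpret prob_space M by fact
  have ci: "cond_iid_bernoulli M p Z" and e[measurable]: "\<epsilon> \<in> measurable M (count_space UNIV)"
    and ind: "indep_set
       (sets (vimage_algebra (space M) (\<lambda>\<omega> i. Z i \<omega>) (PiM UNIV (\<lambda>_. count_space UNIV))))
       (sets (vimage_algebra (space M) \<epsilon> (count_space UNIV)))"
    using mod unfolding random_coefficient_part_def by auto
  have Z[measurable]: "\<And>i. Z i \<in> measurable M (count_space UNIV)"
    using ci unfolding cond_iid_bernoulli_def by auto
  let ?S = "\<lambda>\<omega>. \<Sum>i<y. of_bool (Z i \<omega>) :: nat"
  have le: "?S \<omega> \<le> y" for \<omega>
    using sum_bounded_above[of "{..<y}" "\<lambda>i. of_bool (Z i \<omega>) :: nat" 1] by simp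
  have eq: "{\<omega> \<in> space M. thinned_sum Z \<epsilon> y \<omega> = x} = (\<Union>i\<in>{..min x y}. {\<omega> \<in> space M. ?S \<omega> = i} \<inter> {\<omega> \<in> space M. \<epsilon> \<omega> = x - i})"
    using le by (auto simp: thinned_sum_def)
  have "\<P>(\<omega> in M. thinned_sum Z \<epsilon> y \<omega> = x) = (\<Sum>i\<le>min x y. prob ({\<omega> \<in> space M. ?S \<omega> = i} \<inter> {\<omega> \<in> space M. \<epsilon> \<omega> = x - i}))"
    unfolding eq by (rule finite_measure_finite_Union) (auto simp: disjoint_family_on_def)
  also have "\<dots> = (\<Sum>i\<le>min x y. prob {\<omega> \<in> space M. ?S \<omega> = i} * prob {\<omega> \<in> space M. \<epsilon> \<omega> = x - i})"
  proof (rule sum.cong[OF refl], rule indep_setD[OF ind])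
    fix i
    let ?B = "{f \<in> space (PiM UNIV (\<lambda>_. count_space UNIV)). (\<Sum>j<y. of_bool (f j) :: nat) = i}"
    have "?B \<in> sets (PiM UNIV (\<lambda>_. count_space UNIV))" by measurable
    then show "{\<omega> \<in> space M. ?S \<omega> = i} \<in> sets (vimage_algebra (space M) (\<lambda>\<omega> i. Z i \<omega>) (PiM UNIV (\<lambda>_. count_space UNIV)))"
      by (subst sets_vimage_algebra2) (auto simp: space_PiM intro!: exI[of _ ?B])
    show "{\<omega> \<in> space M. \<epsilon> \<omega> = x - i} \<in> sets (vimage_algebra (space M) \<epsilon> (count_space UNIV))"
      by (subst sets_vimage_algebra2) (auto intro!: exI[of _ "{x - i}"])
  qed
  finally show ?thesis using sum_cond_iid_bernoulli_prob[OF \<open>prob_space M\<close> ci] by simp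
qed

end

theory Submission
  imports Defs
begin

text \<open>
  Write \<open>a\<^sub>n = E[(1 - p)^n]\<close>, \<open>b\<^sub>n = E[(1 - q)^n]\<close>, and \<open>g\<close>, \<open>h\<close> for the masses of \<open>\<epsilon>\<close>, \<open>\<eta>\<close>. Comparing odds
  ratios, a joint law of full support forces \<open>l(x | y) b\<^sub>x h(y) = l(y | x) a\<^sub>y g(x)\<close> for all
  \<open>x\<close>, \<open>y\<close>. The case \<open>y = 1\<close> expresses \<open>g(n + 1) / g(n)\<close> through \<open>r\<^sub>n = b\<^sub>n\<^sub>+\<^sub>1 / (b\<^sub>n - b\<^sub>n\<^sub>+\<^sub>1)\<close>, and
  the case \<open>y = 2\<close> then shows that \<open>r\<close> is affine in \<open>n\<close>. By symmetry the corresponding sequence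
  of \<open>a\<close> is affine, with the same slope \<open>d\<close>. Positivity gives \<open>d \<ge> 0\<close>, and \<open>d = 0\<close> makes both
  coefficients constant. If \<open>d > 0\<close>, then the \<open>a\<^sub>n\<close> and \<open>b\<^sub>n\<close> are the moments of beta laws with
  \<open>\<alpha> = 1 / d\<close>, which are determined by their moments, and the recurrences for \<open>g\<close> and \<open>h\<close> are
  those of negative binomial masses. Conversely, for such laws the candidate joint mass is a constant times
  \<open>\<Sum>i. (\<alpha>)\<^sub>i / i! * (\<beta>\<^sub>1)\<^sub>y\<^sub>-\<^sub>i / (y - i)! * (\<beta>\<^sub>2)\<^sub>x\<^sub>-\<^sub>i / (x - i)! * (1 - \<theta>)^(x + y - i)\<close>, which is
  symmetric under exchanging the two coordinates together with \<open>\<beta>\<^sub>1\<close> and \<open>\<beta>\<^sub>2\<close>.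
\<close>

section \<open>Beta and negative binomial laws\<close>

text \<open>The Taylor polynomials of the characteristic function have the moments as coefficients.
  For values in the unit interval the remainder is at most
  \<open>2 * \<bar>t\<bar> ^ n / fact n\<close>, so the moments fix the characteristic function and
  Levy uniqueness applies.\<close>

lemma distr_eq_if_moments_eq:
  fixes X :: "'a \<Rightarrow> real" and Y :: "'b \<Rightarrow> real"
  assumes "prob_space M" "prob_space N"
    and X: "X \<in> borel_measurable M" "AE x in M. 0 \<le> X x \<and> X x \<le> 1"
    and Y: "Y \<in> borel_measurable N" "AE x in N. 0 \<le> Y x \<and> Y x \<le> 1"
    and eq: "\<And>n. (\<integral>x. X x ^ n \<partial>M) = (\<integral>x. Y x ^ n \<partial>N)"
  shows "distr M borel X = distr N borel Y"
proof -
  interpret M: prob_space M by fact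
  interpret N: prob_space N by fact
  have approx: "(\<lambda>n. \<Sum>k\<le>n. (\<i> * t)^k / fact k * complex_of_real (\<integral>x. U x ^ k \<partial>P)) \<longlonglongrightarrow> char (distr P borel U) t"
    if P: "prob_space P" and U: "U \<in> borel_measurable P" "AE x in P. 0 \<le> U x \<and> U x \<le> 1"
    for P :: "'c measure" and U :: "'c \<Rightarrow> real" and t :: real
  proof -
    interpret P: prob_space P by fact
    have bd: "AE x in P. norm (U x ^ k) \<le> 1" for k
      using U(2) by eventually_elim (auto simp: power_le_one)
    have int: "integrable P (\<lambda>x. U x ^ k)" for k
      by (rule P.integrable_const_bound[where B = 1]) (use bd U(1) in auto)
    have le1: "(\<integral>x. \<bar>U x\<bar> ^ n \<partial>P) \<le> 1" for n
    proof -
      have "(\<integral>x. \<bar>U x\<bar> ^ n \<partial>P) \<le> (\<integral>x. 1 \<partial>P)"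
      proof (rule integral_mono_AE)
        show "integrable P (\<lambda>x. \<bar>U x\<bar> ^ n)"
          using integrable_abs[OF int[of n]] by (simp add: power_abs)
        show "AE x in P. \<bar>U x\<bar> ^ n \<le> 1"
          using bd[of n] by (simp add: power_abs)
      qed simp
      then show ?thesis by (simp add: P.prob_space)
    qed
    have lim: "(\<lambda>n. 2 * (\<bar>t\<bar>^n / fact n)) \<longlonglongrightarrow> 2 * 0"
      using summable_LIMSEQ_zero[OF summable_exp[of "\<bar>t\<bar>"]]
      by (intro tendsto_mult tendsto_const) (simp add: divide_inverse mult.commute)
    have bound: "cmod (char (distr P borel U) t - (\<Sum>k\<le>n. (\<i> * t)^k / fact k * complex_of_real (\<integral>x. U x ^ k \<partial>P)))
        \<le> 2 * (\<bar>t\<bar>^n / fact n)" for n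
    proof -
      have "cmod (char (distr P borel U) t - (\<Sum>k\<le>n. (\<i> * t)^k / fact k * complex_of_real (\<integral>x. U x ^ k \<partial>P)))
        \<le> 2 * \<bar>t\<bar>^n / fact n * (\<integral>x. \<bar>U x\<bar> ^ n \<partial>P)"
        by (rule P.char_approx1'[OF int U(1) refl])
      also have "\<dots> \<le> 2 * \<bar>t\<bar>^n / fact n * 1"
        by (rule mult_left_mono[OF le1]) simp
      finally show ?thesis by simp
    qed
    have "(\<lambda>n. char (distr P borel U) t - (\<Sum>k\<le>n. (\<i> * t)^k / fact k * complex_of_real (\<integral>x. U x ^ k \<partial>P))) \<longlonglongrightarrow> 0"
      by (rule Lim_null_comparison[OF always_eventually]) (use bound lim in auto)
    from tendsto_diff[OF tendsto_const this, of "char (distr P borel U) t"] show ?thesis by simp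
  qed
  have "char (distr M borel X) t = char (distr N borel Y) t" for t
    using LIMSEQ_unique[OF approx[OF assms(1) X] approx[OF assms(2) Y, folded eq]] .
  then show ?thesis
    by (intro Levy_uniqueness M.real_distribution_distr N.real_distribution_distr X Y) auto
qed

section \<open>Negative binomial masses and the binomial series\<close>

lemma pos_real_notin_nonpos_Ints: "0 < (r :: real) \<Longrightarrow> r \<notin> \<int>\<^sub>\<le>\<^sub>0"
  by (auto elim!: nonpos_Ints_cases)

lemma neg_binomial_mass_pochhammer:
  "0 < r \<Longrightarrow> neg_binomial_mass r \<theta> n = pochhammer r n / fact n * \<theta> powr r * (1 - \<theta>) ^ n"
  by (simp add: neg_binomial_mass_def pochhammer_Gamma pos_real_notin_nonpos_Ints add.commute)

text \<open>This is Newton's binomial series with exponent \<open>- r\<close> at the point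
  \<open>- x\<close>; the signs of the generalised binomial coefficients cancel those of
  \<open>(- x) ^ n\<close>.\<close>

lemma sums_pochhammer_fact:
  fixes x r :: real
  assumes "\<bar>x\<bar> < 1"
  shows "(\<lambda>n. pochhammer r n / fact n * x ^ n) sums (1 - x) powr (- r)"
proof -
  have "(- r gchoose n) * (- x) ^ n = pochhammer r n / fact n * x ^ n" for n
    by (simp add: gbinomial_pochhammer flip: power_mult_distrib)
  then show ?thesis using gen_binomial_real[of "- x" "- r"] assms by simp
qed

lemma neg_binomial_mass_sums:
  assumes "0 < r" "0 < \<theta>" "\<theta> < 1"
  shows "neg_binomial_mass r \<theta> sums 1"
proof -
  have "(\<lambda>n. \<theta> powr r * (pochhammer r n / fact n * (1 - \<theta>) ^ n)) sums (\<theta> powr r * \<theta> powr (- r))"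
    by (rule sums_mult) (use sums_pochhammer_fact[of "1 - \<theta>" r] assms in simp)
  moreover have "neg_binomial_mass r \<theta> = (\<lambda>n. \<theta> powr r * (pochhammer r n / fact n * (1 - \<theta>) ^ n))"
    using assms by (simp add: neg_binomial_mass_pochhammer fun_eq_iff)
  ultimately show ?thesis using assms by (simp flip: powr_add)
qed

lemma neg_binomial_mass_pos:
  "0 < r \<Longrightarrow> 0 < \<theta> \<Longrightarrow> \<theta> < 1 \<Longrightarrow> 0 < neg_binomial_mass r \<theta> n"
  by (simp add: neg_binomial_mass_pochhammer pochhammer_pos)

text \<open>If \<open>c \<ge> 1\<close>, the terms dominate a multiple of the harmonic series: one
  factor \<open>r\<close> splits off, and \<open>pochhammer (r + 1) n\<close> is at least
  \<open>fact n\<close> factor by factor.\<close>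

lemma summable_pochhammer_fact_imp_less_1:
  fixes r c :: real
  assumes "0 < r" "0 < c" "summable (\<lambda>n. pochhammer r n / fact n * c ^ n)"
  shows "c < 1"
proof (rule ccontr)
  assume "\<not> c < 1"
  have lb: "r * inverse (real (Suc n)) \<le> pochhammer r (Suc n) / fact (Suc n)" for n
  proof -
    have "pochhammer r (Suc n) / fact (Suc n) = r * (pochhammer (r + 1) n / fact n) / real (Suc n)"
      by (simp add: pochhammer_rec)
    moreover have "fact n \<le> pochhammer (r + 1) n"
      unfolding pochhammer_fact pochhammer_prod by (rule prod_mono) (use assms in auto)
    then have "1 \<le> pochhammer (r + 1) n / fact n" by simp
    then have "r * 1 / real (Suc n) \<le> r * (pochhammer (r + 1) n / fact n) / real (Suc n)"
      using assms by (intro divide_right_mono mult_left_mono) auto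
    ultimately show ?thesis by (simp only: divide_inverse mult_1_right)
  qed
  have "r * inverse (real (Suc n)) \<le> pochhammer r (Suc n) / fact (Suc n) * c ^ Suc n" for n
    using mult_mono[OF lb[of n] one_le_power[of c "Suc n"]] \<open>\<not> c < 1\<close> assms
    by (auto simp: pochhammer_nonneg simp del: power_Suc fact_Suc)
  moreover have "summable (\<lambda>n. pochhammer r (Suc n) / fact (Suc n) * c ^ Suc n)"
    using assms(3) by (rule summable_Suc_iff[THEN iffD2])
  moreover have "norm (r * inverse (real (Suc n))) = r * inverse (real (Suc n))" for n
    using assms(1) by simp
  ultimately have "summable (\<lambda>n. r * inverse (real (Suc n)))"
    by - (erule summable_comparison_test'[of _ 0], simp only:)
  from summable_mult[OF this, of "inverse r"] have "summable (\<lambda>n. inverse (real (Suc n)))"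
    using assms(1) by (simp del: of_nat_Suc)
  then show False
    using not_summable_harmonic[where 'a = real] by (simp only: summable_Suc_iff[of "\<lambda>n. inverse (real n)"])
qed

section \<open>Beta laws and their moments\<close>

lemma Beta_shift:
  fixes a b :: real
  assumes "0 < a" "0 < b"
  shows "Beta (a + real i) (b + real j) / Beta a b
    = pochhammer a i * pochhammer b j / pochhammer (a + b) (i + j)"
  using assms by (simp add: Beta_def pochhammer_Gamma pos_real_notin_nonpos_Ints add_ac)

lemma beta_density_nonneg: "0 < a \<Longrightarrow> 0 < b \<Longrightarrow> 0 \<le> beta_density a b x"
  by (auto simp: beta_density_def Beta_def intro!: divide_nonneg_nonneg mult_nonneg_nonneg Gamma_real_nonneg)

lemma beta_density_measurable[measurable]: "beta_density a b \<in> borel_measurable borel"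
  unfolding beta_density_def[abs_def] by measurable

lemma has_bochner_integral_beta_density:
  assumes ab: "0 < a" "0 < b"
  shows "has_bochner_integral lborel (\<lambda>x. beta_density a b x * (x ^ i * (1 - x) ^ j))
    (pochhammer a i * pochhammer b j / pochhammer (a + b) (i + j))"
proof -
  let ?f = "\<lambda>x. x powr (a + real i - 1) * (1 - x) powr (b + real j - 1)"
  have Beta: "0 < Beta a b"
    using ab by (simp add: Beta_def)
  \<comment> \<open>At the endpoints both sides vanish, since \<open>0 powr z = 0\<close> for every
    \<open>z\<close>.\<close>
  have eq: "beta_density a b x * (x ^ i * (1 - x) ^ j) = indicator {0..1} x * ?f x / Beta a b" for x
    by (auto simp: beta_density_def indicator_def powr_add[symmetric] simp flip: powr_realpow)
       (simp_all add: powr_add powr_diff)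
  have "(\<integral>\<^sup>+x. ennreal (indicator {0..1} x * ?f x) \<partial>lborel) = Beta (a + real i) (b + real j)"
    by (rule nn_integral_has_integral_lebesgue) (use has_integral_Beta_real[of "a + i" "b + j"] ab in auto)
  then have "has_bochner_integral lborel (\<lambda>x. indicator {0..1} x * ?f x) (Beta (a + real i) (b + real j))"
    using ab by (intro has_bochner_integral_nn_integral) (auto simp: Beta_def Gamma_real_nonneg)
  from has_bochner_integral_divide_zero[OF this, of "Beta a b"] show ?thesis
    unfolding eq Beta_shift[OF ab] .
qed

lemma prob_space_beta:
  assumes "0 < a" "0 < b"
  shows "prob_space (density lborel (\<lambda>x. ennreal (beta_density a b x)))"
proof
  have "(\<integral>\<^sup>+x. ennreal (beta_density a b x) \<partial>lborel) = ennreal 1"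
    using has_bochner_integral_beta_density[OF assms, of 0 0] beta_density_nonneg[OF assms]
    by (subst nn_integral_eq_integral) (auto simp: has_bochner_integral_iff)
  then show "emeasure (density lborel (\<lambda>x. ennreal (beta_density a b x)))
      (space (density lborel (\<lambda>x. ennreal (beta_density a b x)))) = 1"
    by (simp add: emeasure_density)
qed

lemma integral_density_beta:
  assumes "0 < a" "0 < b"
  shows "(\<integral>x. x ^ i * (1 - x) ^ j \<partial>density lborel (\<lambda>x. ennreal (beta_density a b x)))
    = pochhammer a i * pochhammer b j / pochhammer (a + b) (i + j)"
  using has_bochner_integral_beta_density[OF assms, of i j] beta_density_nonneg[OF assms]
  by (subst integral_density) (auto simp: has_bochner_integral_iff)

lemma beta_distributed_moment:
  assumes "0 < a" "0 < b" "beta_distributed M p a b"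
  shows "(\<integral>\<omega>. p \<omega> ^ i * (1 - p \<omega>) ^ j \<partial>M) = pochhammer a i * pochhammer b j / pochhammer (a + b) (i + j)"
proof -
  have "(\<integral>\<omega>. p \<omega> ^ i * (1 - p \<omega>) ^ j \<partial>M) = (\<integral>x. x ^ i * (1 - x) ^ j \<partial>distr M lborel p)"
    using assms(3) by (subst integral_distr) (auto simp: beta_distributed_def distributed_def)
  also have "distr M lborel p = density lborel (\<lambda>x. ennreal (beta_density a b x))"
    using assms(3) by (simp add: beta_distributed_def distributed_def)
  finally show ?thesis using integral_density_beta[OF assms(1,2)] by simp
qed

lemma beta_distributedI:
  assumes "prob_space M" and ab: "0 < a" "0 < b"
    and p[measurable]: "p \<in> borel_measurable M" and p01: "AE \<omega> in M. 0 \<le> p \<omega> \<and> p \<omega> \<le> 1"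
    and mom: "\<And>n. (\<integral>\<omega>. (1 - p \<omega>) ^ n \<partial>M) = pochhammer b n / pochhammer (a + b) n"
  shows "beta_distributed M p a b"
proof -
  let ?D = "density lborel (\<lambda>x. ennreal (beta_density a b x))"
  \<comment> \<open>The given moments are those of \<open>1 - p\<close>, so the reflected laws are
    identified first and then reflected back.\<close>
  have "distr M borel (\<lambda>\<omega>. 1 - p \<omega>) = distr ?D borel (\<lambda>x. 1 - x)"
  proof (rule distr_eq_if_moments_eq[OF assms(1) prob_space_beta[OF ab]])
    show "AE \<omega> in M. 0 \<le> 1 - p \<omega> \<and> 1 - p \<omega> \<le> 1"
      using p01 by eventually_elim auto
    show "AE x in ?D. 0 \<le> 1 - x \<and> 1 - x \<le> 1"
      by (subst AE_density) (auto simp: beta_density_def)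
    show "(\<integral>\<omega>. (1 - p \<omega>) ^ n \<partial>M) = (\<integral>x. (1 - x) ^ n \<partial>?D)" for n
      using integral_density_beta[OF ab, of 0 n] mom by simp
  qed auto
  then have "distr (distr M borel (\<lambda>\<omega>. 1 - p \<omega>)) borel (\<lambda>x. 1 - x)
      = distr (distr ?D borel (\<lambda>x. 1 - x)) borel (\<lambda>x. 1 - x)" by simp
  then have "distr M borel p = distr ?D borel (\<lambda>x. x)"
    by (subst (asm) (1 2) distr_distr) (auto simp: comp_def)
  then have "distr M lborel p = ?D"
    by (metis distr_cong distr_id2 sets_density sets_lborel)
  then show ?thesis
    by (simp add: beta_distributed_def distributed_def)
qed

section \<open>The moment recurrences\<close>

text \<open>
  \<open>A i j\<close> and \<open>B i j\<close> stand for \<open>E[p^i (1 - p)^j]\<close> and \<open>E[q^i (1 - q)^j]\<close>.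
\<close>

locale balanced_moments =
  fixes A B :: "nat \<Rightarrow> nat \<Rightarrow> real" and g h :: "nat \<Rightarrow> real"
  assumes A_split: "A i j = A (Suc i) j + A i (Suc j)"
    and B_split: "B i j = B (Suc i) j + B i (Suc j)"
    and A_00: "A 0 0 = 1" and B_00: "B 0 0 = 1"
    and A_nonneg: "0 \<le> A i j" and B_nonneg: "0 \<le> B i j"
    and A_pos: "0 < A 0 n" and B_pos: "0 < B 0 n"
    and g_pos: "0 < g n" and h_pos: "0 < h n"
    and balance: "(\<Sum>i\<le>min x y. real (y choose i) * A i (y - i) * g (x - i)) * B 0 x * h y
      = (\<Sum>i\<le>min y x. real (x choose i) * B i (x - i) * h (y - i)) * A 0 y * g x"
begin

text \<open>The axioms are invariant under exchanging \<open>A\<close> with \<open>B\<close> and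
  \<open>g\<close> with \<open>h\<close>, so every result about \<open>B\<close> and
  \<open>g\<close> transfers to \<open>A\<close> and \<open>h\<close>.\<close>

lemma swap: "balanced_moments B A h g"
  by unfold_locales
     (rule B_split A_split A_00 B_00 A_nonneg B_nonneg A_pos B_pos g_pos h_pos balance[symmetric])+

text \<open>In the balance at \<open>y = 1\<close> the terms with \<open>i = 0\<close> give the same
  product on both sides and cancel.\<close>

lemma balance_1:
  "A 1 0 * h 1 * g n * B 0 (Suc n) = A 0 1 * h 0 * real (Suc n) * B 1 n * g (Suc n)"
  using balance[where x = "Suc n" and y = 1] by (simp add: algebra_simps)

lemma balance_2:
  "(A 0 2 * g (n + 2) + 2 * A 1 1 * g (Suc n) + A 2 0 * g n) * B 0 (n + 2) * h 2
   = (B 0 (n + 2) * h 2 + real (n + 2) * B 1 (Suc n) * h 1 + real (n + 2) * real (Suc n) / 2 * B 2 n * h 0)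
     * A 0 2 * g (n + 2)"
proof -
  \<comment> \<open>Taking \<open>x = n + 2\<close> ensures that both sums have exactly three
    terms.\<close>
  have set: "{..min (n + 2) 2} = {0, 1, 2}" "{..min 2 (n + 2)} = {0, 1, 2}" by auto
  have e1: "(\<Sum>i\<le>min (n + 2) 2. real (2 choose i) * A i (2 - i) * g (n + 2 - i))
      = A 0 2 * g (n + 2) + 2 * A 1 1 * g (Suc n) + A 2 0 * g n"
    unfolding set by simp
  have e2: "(\<Sum>i\<le>min 2 (n + 2). real (n + 2 choose i) * B i (n + 2 - i) * h (2 - i))
      = B 0 (n + 2) * h 2 + real (n + 2) * B 1 (Suc n) * h 1 + real (n + 2 choose 2) * B 2 n * h 0"
    unfolding set by simp
  have e3: "real (n + 2 choose 2) = real (n + 2) * real (Suc n) / 2"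
    by (induction n) (simp_all add: numeral_2_eq_2 field_simps)
  show ?thesis
    using balance[where x = "n + 2" and y = 2] unfolding e1 e2 e3 .
qed

text \<open>For a beta law with parameters \<open>\<alpha>\<close>, \<open>\<beta>\<close> this
  ratio is \<open>(\<beta> + n) / \<alpha>\<close>, so affine growth is what characterises the beta
  moments.\<close>

definition r :: "nat \<Rightarrow> real" where "r n = B 0 (Suc n) / B 1 n"
definition s :: "nat \<Rightarrow> real" where "s n = A 0 (Suc n) / A 1 n"
text \<open>The constant factor in the recurrences \<open>g_Suc\<close> and \<open>h_Suc\<close>;
  for the laws sought it equals \<open>\<alpha> * (1 - \<theta>)\<close>.\<close>

definition c :: real where "c = A 1 0 * h 1 / (A 0 1 * h 0)"

end

text \<open>The excluded case is that of a coefficient vanishing almost surely. By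
  \<open>B_1_pos\<close> the condition passes to \<open>B\<close>, so the exchange symmetry
  survives.\<close>

locale nondegenerate_balanced_moments = balanced_moments +
  assumes A_10: "A 1 0 \<noteq> 0"
begin

lemma B_1_pos: "0 < B 1 n"
proof -
  have "0 < A 1 0 * h 1 * g n * B 0 (Suc n)"
    using A_10 A_nonneg[of 1 0] h_pos g_pos B_pos by simp
  then have "B 1 n \<noteq> 0" unfolding balance_1 by auto
  then show ?thesis using B_nonneg[of 1 n] by simp
qed

lemma swap: "nondegenerate_balanced_moments B A h g"
  using B_1_pos[of 0] swap
  by (intro nondegenerate_balanced_moments.intro nondegenerate_balanced_moments_axioms.intro) auto

lemma A_1_pos: "0 < A 1 n"
  by (rule nondegenerate_balanced_moments.B_1_pos[OF swap])

lemma r_pos: "0 < r n" and s_pos: "0 < s n" and c_pos: "0 < c"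
  using A_1_pos B_1_pos A_pos B_pos h_pos by (simp_all add: r_def s_def c_def)

lemma g_Suc: "g (Suc n) = g n * c * r n / real (Suc n)"
proof -
  have "A 0 1 \<noteq> 0" "h 0 \<noteq> 0" "B 1 n \<noteq> 0" "real (Suc n) \<noteq> 0"
    using A_pos h_pos[of 0] B_1_pos[of n] by (auto simp: less_imp_neq[THEN not_sym])
  then show ?thesis
    using balance_1[of n] unfolding r_def c_def by (simp add: divide_simps del: of_nat_Suc) (simp only: mult_ac)
qed

text \<open>The case \<open>n = 0\<close> of \<open>g_Suc\<close> computes \<open>g 1 / g 0\<close>.
  The invariance of \<open>c\<close> is one half of the reason why both noise laws share the
  parameter \<open>\<theta>\<close>; the common slope is the other.\<close>

lemma c_swap: "balanced_moments.c B g = c"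
proof -
  have "balanced_moments.c B g = B 1 0 * g 1 / (B 0 1 * g 0)"
    by (rule balanced_moments.c_def) (rule nondegenerate_balanced_moments.axioms(1)[OF swap])
  also have "\<dots> = c"
    using g_Suc[of 0] g_pos[of 0] B_pos[of 1] B_1_pos[of 0] by (simp add: r_def field_simps)
  finally show ?thesis .
qed

lemma r_swap: "balanced_moments.r A = s" and s_swap: "balanced_moments.s B = r"
  using balanced_moments.r_def[OF nondegenerate_balanced_moments.axioms(1)[OF swap]]
    balanced_moments.s_def[OF nondegenerate_balanced_moments.axioms(1)[OF swap]]
  by (auto simp: fun_eq_iff r_def s_def)

lemma h_Suc: "h (Suc n) = h n * c * s n / real (Suc n)"
  using nondegenerate_balanced_moments.g_Suc[OF swap] by (simp add: c_swap r_swap)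

text \<open>Turns the second-order moment left over in \<open>balance_2\<close> into an increment of
  \<open>r\<close>. Splitting reduces every moment to \<open>B 0 (n + 2)\<close>,
  \<open>B 1 (Suc n)\<close> and \<open>B 1 n\<close>, which are \<open>u\<close>, \<open>v\<close>,
  \<open>w\<close> in the rational identity.\<close>

lemma r_Suc_diff_eq: "B 2 n * r n * r (Suc n) / B 0 (n + 2) = 1 + r (Suc n) - r n"
proof -
  have "B 0 (Suc n) = B 1 (Suc n) + B 0 (n + 2)" "B 1 n = B 2 n + B 1 (Suc n)"
    using B_split[of 0 "Suc n"] B_split[of 1 n] by (simp_all add: numeral_2_eq_2)
  then have "B 0 (Suc n) = B 1 (Suc n) + B 0 (n + 2)" "B 2 n = B 1 n - B 1 (Suc n)" by simp_all
  moreover have "(w - v) * ((v + u) / w) * (u / v) / u = 1 + u / v - (v + u) / w"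
    if "0 < u" "0 < v" "0 < w" for u v w :: real
    using that by (simp add: divide_simps) (simp add: algebra_simps)
  ultimately show ?thesis
    using B_pos[of "n + 2"] B_1_pos[of n] B_1_pos[of "Suc n"] by (simp add: r_def)
qed

lemma s_Suc_diff_eq: "A 2 n * s n * s (Suc n) / A 0 (n + 2) = 1 + s (Suc n) - s n"
  using nondegenerate_balanced_moments.r_Suc_diff_eq[OF swap] by (simp add: r_swap)

text \<open>By the case \<open>y = 1\<close>, the first two terms on each side of \<open>balance_2\<close> agree.\<close>

lemma r_diff: "r (Suc n) - r n = s 1 - s 0"
proof -
  define k l where "k = real (Suc n)" and "l = real (n + 2)"
  have g1: "g (Suc n) = g n * c * r n / k" unfolding k_def by (rule g_Suc)
  have g2: "g (n + 2) = g n * c * r n / k * c * r (Suc n) / l"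
    using g_Suc[of "Suc n"] g1 by (simp add: l_def)
  have h1: "h 1 = h 0 * c * s 0" using h_Suc[of 0] by simp
  have h2: "h 2 = h 0 * c * s 0 * c * s 1 / 2" using h_Suc[of 1] h1 by (simp add: numeral_2_eq_2)
  have e1: "A 0 2 = s 1 * A 1 1" using A_1_pos[of 1] by (simp add: s_def numeral_2_eq_2)
  have e2: "B 0 (n + 2) = r (Suc n) * B 1 (Suc n)" using B_1_pos[of "Suc n"] by (simp add: r_def)
  have pos: "0 < h 0" "0 < g n" "0 < c" "0 < r n" "0 < r (Suc n)" "0 < s 0" "0 < s 1" "0 < A 0 2" "0 < B 0 (n + 2)" "0 < k" "0 < l"
    using h_pos g_pos c_pos r_pos s_pos A_pos B_pos by (auto simp: k_def l_def)
  have "2 * A 1 1 * g (Suc n) * B 0 (n + 2) * h 2 = l * B 1 (Suc n) * h 1 * A 0 2 * g (n + 2)"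
    unfolding g1 g2 h1 h2 e1 e2 using pos by (simp add: divide_simps)
  then have "A 2 0 * g n * B 0 (n + 2) * h 2 = l * k / 2 * B 2 n * h 0 * A 0 2 * g (n + 2)"
    using balance_2[of n, folded k_def l_def] by (simp add: algebra_simps)
  then have "A 2 0 * B 0 (n + 2) * (s 0 * s 1) * (g n * h 0 * c * c) = B 2 n * A 0 2 * (r n * r (Suc n)) * (g n * h 0 * c * c)"
    unfolding g2 h2 using pos by (simp add: divide_simps)
  then have "A 2 0 * B 0 (n + 2) * (s 0 * s 1) = B 2 n * A 0 2 * (r n * r (Suc n))"
    using pos by simp
  then have "A 2 0 * s 0 * s 1 / A 0 2 = B 2 n * r n * r (Suc n) / B 0 (n + 2)"
    using pos by (simp add: field_simps)
  \<comment> \<open>The left quotient is \<open>1 + s 1 - s 0\<close>, whatever \<open>n\<close> is,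
    and the right one is \<open>1 + r (Suc n) - r n\<close>.\<close>
  then show ?thesis using r_Suc_diff_eq[of n] s_Suc_diff_eq[of 0] by (simp add: numeral_2_eq_2)
qed

section \<open>Affine ratios and the resulting closed forms\<close>

lemma r_eq: "r n = r 0 + real n * (s 1 - s 0)"
proof (induction n)
  case (Suc n)
  then show ?case using r_diff[of n] by (simp add: algebra_simps)
qed simp

text \<open>A negative slope would eventually make the positive sequence \<open>r\<close>
  negative.\<close>

lemma s_diff_nonneg: "0 \<le> s 1 - s 0"
proof (rule ccontr)
  assume neg: "\<not> 0 \<le> s 1 - s 0"
  then obtain n where "r 0 < real n * (s 0 - s 1)"
    using reals_Archimedean3[of "s 0 - s 1"] by auto
  then show False using r_pos[of n] r_eq[of n] by (simp add: algebra_simps)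
qed

text \<open>Slope zero gives \<open>r 0 = r 1\<close>; cross-multiplied, this says that the variance
  of \<open>1 - q\<close> is zero.\<close>

lemma B_variance_0: "s 1 = s 0 \<Longrightarrow> B 0 2 = (B 0 1)\<^sup>2"
proof -
  assume "s 1 = s 0"
  then have "r 1 = r 0" using r_eq[of 1] by simp
  moreover have "B 1 0 = 1 - B 0 1" "B 1 1 = B 0 1 - B 0 2"
    using B_split[of 0 0] B_split[of 0 1] by (simp_all add: B_00 numeral_2_eq_2)
  ultimately have "B 0 2 * (1 - B 0 1) = B 0 1 * (B 0 1 - B 0 2)"
    using B_1_pos[of 0] B_1_pos[of 1] by (simp add: r_def frac_eq_eq numeral_2_eq_2)
  then show ?thesis by (simp add: algebra_simps power2_eq_square)
qed

lemma A_variance_0: "s 1 = s 0 \<Longrightarrow> A 0 2 = (A 0 1)\<^sup>2"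
  using nondegenerate_balanced_moments.B_variance_0[OF swap] r_diff[of 0] by (simp add: s_swap)

context
  assumes nonconst: "s 1 \<noteq> s 0"
begin

lemma s_diff_pos: "0 < s 1 - s 0"
  using nonconst s_diff_nonneg by simp

lemma r_eq': "r n = (s 1 - s 0) * (r 0 / (s 1 - s 0) + real n)"
  using s_diff_pos by (subst r_eq) (simp add: field_simps)

text \<open>Successive moments have quotient \<open>r n / (1 + r n)\<close>. For affine
  \<open>r\<close> this is a quotient of two linear factors in \<open>n\<close>, one for each
  Pochhammer symbol.\<close>

lemma B_0_eq:
  "B 0 n = pochhammer (r 0 / (s 1 - s 0)) n / pochhammer (1 / (s 1 - s 0) + r 0 / (s 1 - s 0)) n"
proof (induction n)
  case (Suc n)
  let ?d = "s 1 - s 0"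
  have "B 0 n = B 1 n + B 0 (Suc n)" using B_split[of 0 n] by simp
  then have "B 0 (Suc n) = B 0 n * (r n / (1 + r n))"
    using B_1_pos[of n] B_pos[of "Suc n"] by (simp add: r_def field_simps)
  also have "r n / (1 + r n) = (r 0 / ?d + real n) / (1 / ?d + r 0 / ?d + real n)"
  proof -
    have "1 + r n = ?d * (1 / ?d + r 0 / ?d + real n)"
      using s_diff_pos by (subst r_eq') (simp add: algebra_simps)
    then show ?thesis using s_diff_pos by (subst r_eq') simp
  qed
  finally show ?case by (simp add: Suc pochhammer_Suc)
qed (simp add: B_00)

lemma g_eq: "g n = g 0 * (pochhammer (r 0 / (s 1 - s 0)) n / fact n * (c * (s 1 - s 0)) ^ n)"
proof (induction n)
  case (Suc n)
  show ?case unfolding g_Suc by (subst r_eq', subst Suc) (simp add: pochhammer_Suc mult_ac)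
qed simp

end

lemma beta_form:
  assumes "s 1 \<noteq> s 0"
  obtains \<alpha> \<beta>\<^sub>1 \<beta>\<^sub>2 \<rho> where "0 < \<alpha>" "0 < \<beta>\<^sub>1" "0 < \<beta>\<^sub>2" "0 < \<rho>"
    "\<And>n. A 0 n = pochhammer \<beta>\<^sub>1 n / pochhammer (\<alpha> + \<beta>\<^sub>1) n"
    "\<And>n. B 0 n = pochhammer \<beta>\<^sub>2 n / pochhammer (\<alpha> + \<beta>\<^sub>2) n"
    "\<And>n. g n = g 0 * (pochhammer \<beta>\<^sub>2 n / fact n * \<rho> ^ n)"
    "\<And>n. h n = h 0 * (pochhammer \<beta>\<^sub>1 n / fact n * \<rho> ^ n)"
proof -
  \<comment> \<open>Equal slopes make the exchanged instance produce the same
    \<open>\<alpha>\<close>, the inverse slope, and the same \<open>\<rho>\<close>, which is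
    \<open>c\<close> times the slope.\<close>
  have d: "r 1 - r 0 = s 1 - s 0" using r_diff[of 0] by simp
  with assms have ne: "r 1 \<noteq> r 0" by simp
  interpret sw: nondegenerate_balanced_moments B A h g by (rule swap)
  show ?thesis
  proof (rule that[of "1 / (s 1 - s 0)" "s 0 / (s 1 - s 0)" "r 0 / (s 1 - s 0)" "c * (s 1 - s 0)"])
    show "A 0 n = pochhammer (s 0 / (s 1 - s 0)) n / pochhammer (1 / (s 1 - s 0) + s 0 / (s 1 - s 0)) n" for n
      using sw.B_0_eq ne by (simp add: r_swap s_swap d[simplified])
    show "h n = h 0 * (pochhammer (s 0 / (s 1 - s 0)) n / fact n * (c * (s 1 - s 0)) ^ n)" for n
      using sw.g_eq[of n] ne by (simp add: r_swap s_swap c_swap d[simplified])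
    show "B 0 n = pochhammer (r 0 / (s 1 - s 0)) n / pochhammer (1 / (s 1 - s 0) + r 0 / (s 1 - s 0)) n" for n
      by (rule B_0_eq[OF assms])
    show "g n = g 0 * (pochhammer (r 0 / (s 1 - s 0)) n / fact n * (c * (s 1 - s 0)) ^ n)" for n
      by (rule g_eq[OF assms])
  qed (use s_diff_pos[OF assms] r_pos s_pos c_pos in simp_all)
qed

end

section \<open>Compatible conditional laws\<close>

lemma (in prob_space) prob_nat_sums_1:
  assumes [measurable]: "X \<in> measurable M (count_space (UNIV :: nat set))"
  shows "(\<lambda>n. prob {\<omega> \<in> space M. X \<omega> = n}) sums 1"
proof -
  have "(\<lambda>n. prob {\<omega> \<in> space M. X \<omega> = n}) sums prob (\<Union>n. {\<omega> \<in> space M. X \<omega> = n})"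
    by (rule finite_measure_UNION) (auto simp: disjoint_family_on_def)
  also have "(\<Union>n. {\<omega> \<in> space M. X \<omega> = n}) = space M" by auto
  finally show ?thesis by (simp add: prob_space)
qed

definition mixed_moment :: "'a measure \<Rightarrow> ('a \<Rightarrow> real) \<Rightarrow> nat \<Rightarrow> nat \<Rightarrow> real" where
  "mixed_moment M p i j = (\<integral>\<omega>. p \<omega> ^ i * (1 - p \<omega>) ^ j \<partial>M)"

context prob_space
begin

context
  fixes p :: "'a \<Rightarrow> real"
  assumes p[measurable]: "p \<in> borel_measurable M" and p01: "AE \<omega> in M. 0 \<le> p \<omega> \<and> p \<omega> \<le> 1"
begin

lemma integrable_mixed_moment: "integrable M (\<lambda>\<omega>. p \<omega> ^ i * (1 - p \<omega>) ^ j)"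
proof (rule integrable_const_bound[where B = 1])
  show "AE \<omega> in M. norm (p \<omega> ^ i * (1 - p \<omega>) ^ j) \<le> 1"
    using p01 by eventually_elim (auto simp: abs_mult power_le_one intro!: mult_le_one)
qed simp

lemma mixed_moment_split: "mixed_moment M p i j = mixed_moment M p (Suc i) j + mixed_moment M p i (Suc j)"
proof -
  have "p \<omega> ^ i * (1 - p \<omega>) ^ j = p \<omega> ^ Suc i * (1 - p \<omega>) ^ j + p \<omega> ^ i * (1 - p \<omega>) ^ Suc j" for \<omega>
    by (simp add: algebra_simps)
  then show ?thesis
    unfolding mixed_moment_def
    by (simp only: Bochner_Integration.integral_add[OF integrable_mixed_moment integrable_mixed_moment, symmetric])
qed

lemma mixed_moment_nonneg: "0 \<le> mixed_moment M p i j"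
  unfolding mixed_moment_def
proof (rule integral_nonneg_AE)
  show "AE \<omega> in M. 0 \<le> p \<omega> ^ i * (1 - p \<omega>) ^ j"
    using p01 by eventually_elim simp
qed

lemma mixed_moment_00: "mixed_moment M p 0 0 = 1"
  by (simp add: mixed_moment_def prob_space)

lemma ae_constant_if_mean_0:
  assumes "mixed_moment M p 1 0 = 0"
  shows "ae_constant M p"
proof -
  have "AE \<omega> in M. p \<omega> = 0"
  proof (subst integral_nonneg_eq_0_iff_AE[symmetric])
    show "integrable M p" using integrable_mixed_moment[of 1 0] by simp
    show "AE \<omega> in M. 0 \<le> p \<omega>" using p01 by eventually_elim simp
    show "integral\<^sup>L M p = 0" using assms by (simp add: mixed_moment_def)
  qed
  then show ?thesis by (auto simp: ae_constant_def)
qed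

lemma ae_constant_if_variance_0:
  assumes "mixed_moment M p 0 2 = (mixed_moment M p 0 1)\<^sup>2"
  shows "ae_constant M p"
proof -
  let ?m = "mixed_moment M p 0 1"
  have i1: "integrable M (\<lambda>\<omega>. 1 - p \<omega>)" and i2: "integrable M (\<lambda>\<omega>. (1 - p \<omega>)\<^sup>2)"
    using integrable_mixed_moment[of 0 1] integrable_mixed_moment[of 0 2] by simp_all
  have eq: "(1 - p \<omega> - ?m)\<^sup>2 = (1 - p \<omega>)\<^sup>2 - 2 * ?m * (1 - p \<omega>) + ?m\<^sup>2" for \<omega>
    by (simp add: power2_eq_square algebra_simps)
  have "(\<integral>\<omega>. (1 - p \<omega> - ?m)\<^sup>2 \<partial>M)
      = (\<integral>\<omega>. (1 - p \<omega>)\<^sup>2 \<partial>M) - 2 * ?m * (\<integral>\<omega>. 1 - p \<omega> \<partial>M) + ?m\<^sup>2"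
    unfolding eq using i1 i2
    by (subst Bochner_Integration.integral_add Bochner_Integration.integral_diff; simp add: prob_space del: Bochner_Integration.integral_diff)+
  also have "\<dots> = 0"
    using assms by (simp add: mixed_moment_def power2_eq_square del: Bochner_Integration.integral_diff)
  finally have int0: "(\<integral>\<omega>. (1 - p \<omega> - ?m)\<^sup>2 \<partial>M) = 0" .
  have "integrable M (\<lambda>\<omega>. (1 - p \<omega> - ?m)\<^sup>2)"
    unfolding eq using i1 i2 by simp
  from integral_nonneg_eq_0_iff_AE[OF this] have "AE \<omega> in M. (1 - p \<omega> - ?m)\<^sup>2 = 0"
    using int0 by simp
  then have "AE \<omega> in M. p \<omega> = 1 - ?m" by eventually_elim simp
  then show ?thesis by (auto simp: ae_constant_def)
qed

end

text \<open>The masses sum to 1. Summability forces \<open>\<rho> < 1\<close>, and the binomial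
  series then yields the constant \<open>g0 = (1 - \<rho>) powr r\<close>.\<close>

lemma neg_binomial_distributedI:
  assumes e: "\<epsilon> \<in> measurable M (count_space UNIV)" and pos: "0 < r" "0 < \<rho>"
    and eq: "\<And>n. \<P>(\<omega> in M. \<epsilon> \<omega> = n) = g0 * (pochhammer r n / fact n * \<rho> ^ n)" and g0: "g0 \<noteq> 0"
  shows "\<rho> < 1" "neg_binomial_distributed M \<epsilon> r (1 - \<rho>)"
proof -
  have sum: "(\<lambda>n. g0 * (pochhammer r n / fact n * \<rho> ^ n)) sums 1"
    using prob_nat_sums_1[OF e] unfolding eq .
  then have "summable (\<lambda>n. pochhammer r n / fact n * \<rho> ^ n)"
    using g0 summable_cmult_iff[of g0] by (metis sums_summable)
  then show less: "\<rho> < 1"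
    by (rule summable_pochhammer_fact_imp_less_1[OF pos])
  have "(\<lambda>n. g0 * (pochhammer r n / fact n * \<rho> ^ n)) sums (g0 * (1 - \<rho>) powr (- r))"
    by (rule sums_mult, rule sums_pochhammer_fact) (use less pos in simp)
  then have "g0 * (1 - \<rho>) powr (- r) = 1" using sum sums_unique2 by blast
  then have "g0 = (1 - \<rho>) powr r" using less by (simp add: powr_minus field_simps)
  then show "neg_binomial_distributed M \<epsilon> r (1 - \<rho>)"
    using pos by (simp add: neg_binomial_distributed_def eq neg_binomial_mass_pochhammer)
qed

end

section \<open>Necessity of the beta and negative binomial laws\<close>

text \<open>Full support makes all marginal masses positive, so the conditional probabilities can be
  multiplied out.\<close>

lemma model_joint_law_iff:
  assumes "set_pmf J = UNIV"
  shows "model_joint_law M Z \<epsilon> W \<eta> J \<longleftrightarrow>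
     (\<forall>x y. pmf J (x, y) = measure J {v. snd v = y} * \<P>(\<omega> in M. thinned_sum Z \<epsilon> y \<omega> = x)) \<and>
     (\<forall>x y. pmf J (x, y) = measure J {v. fst v = x} * \<P>(\<omega> in M. thinned_sum W \<eta> x \<omega> = y))"
proof -
  have single: "{v. fst v = x \<and> snd v = y} = {(x, y)}" "{v. snd v = y \<and> fst v = x} = {(x, y)}"
    for x y :: nat by auto
  have "0 < measure J {v. snd v = y}" "0 < measure J {v. fst v = x}" for x y
    using assms by (auto simp: zero_less_measure_iff measure_pmf_zero_iff)
  note nz = this[THEN less_imp_neq, THEN not_sym]
  have [simp]: "range fst = (UNIV :: nat set)" "range snd = (UNIV :: nat set)" by auto
  show ?thesis
    unfolding model_joint_law_def cond_prob_def assms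
    using nz by (auto simp: single measure_pmf_single divide_eq_eq mult.commute)
qed

lemma balanced_moments_if_model_joint_law:
  assumes "prob_space M"
    and rp: "random_coefficient_part M p Z \<epsilon>" and rq: "random_coefficient_part M q W \<eta>"
    and J: "model_joint_law M Z \<epsilon> W \<eta> J" "set_pmf J = UNIV"
  shows "balanced_moments (mixed_moment M p) (mixed_moment M q)
    (\<lambda>n. \<P>(\<omega> in M. \<epsilon> \<omega> = n)) (\<lambda>n. \<P>(\<omega> in M. \<eta> \<omega> = n))"
proof -
  interpret prob_space M by fact
  have p: "p \<in> borel_measurable M" "AE \<omega> in M. 0 \<le> p \<omega> \<and> p \<omega> \<le> 1"
    and q: "q \<in> borel_measurable M" "AE \<omega> in M. 0 \<le> q \<omega> \<and> q \<omega> \<le> 1"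
    using rp rq by (auto simp: random_coefficient_part_def cond_iid_bernoulli_def)
  let ?A = "mixed_moment M p" and ?B = "mixed_moment M q"
  let ?g = "\<lambda>n. \<P>(\<omega> in M. \<epsilon> \<omega> = n)" and ?h = "\<lambda>n. \<P>(\<omega> in M. \<eta> \<omega> = n)"
  define L where "L x y = \<P>(\<omega> in M. thinned_sum Z \<epsilon> y \<omega> = x)" for x y
  define K where "K y x = \<P>(\<omega> in M. thinned_sum W \<eta> x \<omega> = y)" for x y
  have L: "L x y = (\<Sum>i\<le>min x y. real (y choose i) * ?A i (y - i) * ?g (x - i))" for x y
    unfolding L_def mixed_moment_def by (rule thinned_sum_prob[OF assms(1) rp])
  have K: "K y x = (\<Sum>i\<le>min y x. real (x choose i) * ?B i (x - i) * ?h (y - i))" for x y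
    unfolding K_def mixed_moment_def by (rule thinned_sum_prob[OF assms(1) rq])
  have JL: "pmf J (x, y) = measure J {v. snd v = y} * L x y" for x y
    using J(1)[unfolded model_joint_law_iff[OF J(2)]] unfolding L_def by blast
  have JK: "pmf J (x, y) = measure J {v. fst v = x} * K y x" for x y
    using J(1)[unfolded model_joint_law_iff[OF J(2)]] unfolding K_def by blast
  have pos: "0 < pmf J v" for v
    using J by (simp add: pmf_positive)
  have fY: "0 < measure J {v. snd v = y}" and Lpos: "0 < L x y" for x y
    using pos[of "(x, y)"] unfolding JL by (auto simp: zero_less_mult_iff L_def)
  have fX: "0 < measure J {v. fst v = x}" and Kpos: "0 < K y x" for x y
    using pos[of "(x, y)"] unfolding JK by (auto simp: zero_less_mult_iff K_def)
  have L0: "L x 0 = ?g x" "L 0 y = ?A 0 y * ?g 0" and K0: "K y 0 = ?h y" "K 0 x = ?B 0 x * ?h 0" for x y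
    by (simp_all add: L K mixed_moment_00[OF p] mixed_moment_00[OF q])
  have gpos: "0 < ?g n" and hpos: "0 < ?h n" for n
    using Lpos[of n 0] Kpos[of n 0] by (simp_all add: L0 K0)
  have Apos: "0 < ?A 0 n" and Bpos: "0 < ?B 0 n" for n
    using Lpos[of 0 n] Kpos[of 0 n] gpos[of 0] hpos[of 0] by (simp_all add: L0 K0 zero_less_mult_iff)
  have "(\<Sum>i\<le>min x y. real (y choose i) * ?A i (y - i) * ?g (x - i)) * ?B 0 x * ?h y
      = (\<Sum>i\<le>min y x. real (x choose i) * ?B i (x - i) * ?h (y - i)) * ?A 0 y * ?g x" for x y
  proof -
    let ?fX = "\<lambda>x. measure J {v. fst v = x}" and ?fY = "\<lambda>y. measure J {v. snd v = y}"
    \<comment> \<open>Both sides are the product of the masses of \<open>J\<close> at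
      \<open>(x, y)\<close>, \<open>(0, 0)\<close>, \<open>(x, 0)\<close> and \<open>(0, y)\<close>.
      The pairs expanded by conditioning on the second and on the first coordinate are exchanged, so
      the same four marginal masses occur on both sides and cancel.\<close>
    have "(?fY y * L x y) * (?fY 0 * L 0 0) * ((?fX x * K 0 x) * (?fX 0 * K y 0))
        = (?fX x * K y x) * (?fX 0 * K 0 0) * ((?fY 0 * L x 0) * (?fY y * L 0 y))"
      by (simp only: JL[symmetric] JK[symmetric])
    then have "(L x y * (K 0 x * K y 0) * L 0 0) * (?fY y * ?fY 0 * ?fX x * ?fX 0)
        = (K y x * (L x 0 * L 0 y) * K 0 0) * (?fY y * ?fY 0 * ?fX x * ?fX 0)"
      by (simp only: mult_ac)
    moreover have "?fY y * ?fY 0 * ?fX x * ?fX 0 \<noteq> 0"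
      using fX[of x] fX[of 0] fY[of y] fY[of 0] by (simp only: mult_eq_0_iff) linarith
    ultimately have "L x y * (K 0 x * K y 0) * L 0 0 = K y x * (L x 0 * L 0 y) * K 0 0"
      by (simp only: mult_right_cancel simp_thms)
    then have "(L x y * ?B 0 x * ?h y) * (?g 0 * ?h 0) = (K y x * ?A 0 y * ?g x) * (?g 0 * ?h 0)"
      unfolding L0 K0 by (simp add: mixed_moment_00[OF p] mixed_moment_00[OF q] mult_ac)
    moreover have "?g 0 * ?h 0 \<noteq> 0"
      using gpos[of 0] hpos[of 0] by (simp only: mult_eq_0_iff) linarith
    ultimately have "L x y * ?B 0 x * ?h y = K y x * ?A 0 y * ?g x"
      by (simp only: mult_right_cancel simp_thms)
    then show ?thesis
      unfolding L K .
  qed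
  then show ?thesis
    by (intro balanced_moments.intro mixed_moment_split[OF p] mixed_moment_split[OF q] mixed_moment_00[OF p]
        mixed_moment_00[OF q] mixed_moment_nonneg[OF p] mixed_moment_nonneg[OF q] Apos Bpos gpos hpos)
qed

lemma beta_neg_binomial_if_joint_law:
  assumes "prob_space M"
    and rp: "random_coefficient_part M p Z \<epsilon>" and rq: "random_coefficient_part M q W \<eta>"
    and nc: "\<not> (ae_constant M p \<and> ae_constant M q)"
    and J: "model_joint_law M Z \<epsilon> W \<eta> J" "set_pmf J = UNIV"
  shows "\<exists>\<alpha> \<beta>\<^sub>1 \<beta>\<^sub>2 \<theta>. 0 < \<alpha> \<and> 0 < \<beta>\<^sub>1 \<and> 0 < \<beta>\<^sub>2 \<and> 0 < \<theta> \<and> \<theta> < 1 \<and>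
            beta_distributed M p \<alpha> \<beta>\<^sub>1 \<and> beta_distributed M q \<alpha> \<beta>\<^sub>2 \<and>
            neg_binomial_distributed M \<epsilon> \<beta>\<^sub>2 \<theta> \<and> neg_binomial_distributed M \<eta> \<beta>\<^sub>1 \<theta>"
proof -
  interpret prob_space M by fact
  have p: "p \<in> borel_measurable M" "AE \<omega> in M. 0 \<le> p \<omega> \<and> p \<omega> \<le> 1"
    and q: "q \<in> borel_measurable M" "AE \<omega> in M. 0 \<le> q \<omega> \<and> q \<omega> \<le> 1"
    and e: "\<epsilon> \<in> measurable M (count_space UNIV)" "\<eta> \<in> measurable M (count_space UNIV)"
    using rp rq by (auto simp: random_coefficient_part_def cond_iid_bernoulli_def)
  let ?A = "mixed_moment M p" and ?B = "mixed_moment M q"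
  let ?g = "\<lambda>n. \<P>(\<omega> in M. \<epsilon> \<omega> = n)" and ?h = "\<lambda>n. \<P>(\<omega> in M. \<eta> \<omega> = n)"
  interpret balanced_moments ?A ?B ?g ?h
    by (rule balanced_moments_if_model_joint_law[OF assms(1) rp rq J])
  \<comment> \<open>If \<open>p\<close> had mean zero, \<open>balance_1\<close> would give
    \<open>q\<close> mean zero as well, and both would be constant.\<close>
  have A10: "?A 1 0 \<noteq> 0"
  proof
    assume 0: "?A 1 0 = 0"
    then have "?B 1 0 = 0"
      using balance_1[of 0] g_pos[of 1] h_pos[of 0] A_pos[of 1] by simp
    with 0 nc show False
      using ae_constant_if_mean_0[OF p] ae_constant_if_mean_0[OF q] by blast
  qed
  then interpret nondegenerate_balanced_moments ?A ?B ?g ?h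
    by unfold_locales
  \<comment> \<open>Slope zero would make both variances vanish.\<close>
  have "s 1 \<noteq> s 0"
    using nc A_variance_0 B_variance_0 ae_constant_if_variance_0[OF p] ae_constant_if_variance_0[OF q] by blast
  then obtain \<alpha> \<beta>\<^sub>1 \<beta>\<^sub>2 \<rho> where pos: "0 < \<alpha>" "0 < \<beta>\<^sub>1" "0 < \<beta>\<^sub>2" "0 < \<rho>"
    and A: "\<And>n. ?A 0 n = pochhammer \<beta>\<^sub>1 n / pochhammer (\<alpha> + \<beta>\<^sub>1) n"
    and B: "\<And>n. ?B 0 n = pochhammer \<beta>\<^sub>2 n / pochhammer (\<alpha> + \<beta>\<^sub>2) n"
    and g: "\<And>n. ?g n = ?g 0 * (pochhammer \<beta>\<^sub>2 n / fact n * \<rho> ^ n)"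
    and h: "\<And>n. ?h n = ?h 0 * (pochhammer \<beta>\<^sub>1 n / fact n * \<rho> ^ n)"
    by (rule beta_form) blast
  have "?g 0 \<noteq> 0" "?h 0 \<noteq> 0" using g_pos h_pos by (metis less_irrefl)+
  then have "\<rho> < 1" "neg_binomial_distributed M \<epsilon> \<beta>\<^sub>2 (1 - \<rho>)" "neg_binomial_distributed M \<eta> \<beta>\<^sub>1 (1 - \<rho>)"
    using neg_binomial_distributedI[OF e(1) pos(3,4) g] neg_binomial_distributedI[OF e(2) pos(2,4) h] by auto
  moreover have "beta_distributed M p \<alpha> \<beta>\<^sub>1" "beta_distributed M q \<alpha> \<beta>\<^sub>2"
    using A B by (auto intro!: beta_distributedI[OF assms(1) pos(1,2) p] beta_distributedI[OF assms(1) pos(1,3) q]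
        simp: mixed_moment_def)
  ultimately show ?thesis
    using pos by (intro exI[of _ \<alpha>] exI[of _ \<beta>\<^sub>1] exI[of _ \<beta>\<^sub>2] exI[of _ "1 - \<rho>"]) auto
qed

section \<open>Sufficiency: construction of a joint law\<close>

lemma pmf_embed_pmf_nat:
  fixes f :: "nat \<Rightarrow> real"
  assumes "\<And>n. 0 \<le> f n" "f sums 1"
  shows "pmf (embed_pmf f) n = f n"
proof (rule pmf_embed_pmf)
  show "(\<integral>\<^sup>+ n. ennreal (f n) \<partial>count_space UNIV) = 1"
    using assms by (simp add: nn_integral_count_space_nat suminf_ennreal2 sums_iff)
qed (rule assms(1))

lemma exists_joint_pmf:
  fixes f :: "nat \<Rightarrow> real" and L :: "nat \<Rightarrow> nat \<Rightarrow> real"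
  assumes "\<And>y. 0 \<le> f y" "f sums 1" "\<And>x y. 0 \<le> L x y" "\<And>y. (\<lambda>x. L x y) sums 1"
  obtains J where "\<And>x y. pmf J (x, y) = f y * L x y"
proof
  let ?J = "bind_pmf (embed_pmf f) (\<lambda>y. map_pmf (\<lambda>x. (x, y)) (embed_pmf (\<lambda>x. L x y)))"
  fix x y
  have "pmf (map_pmf (\<lambda>x. (x, z)) (embed_pmf (\<lambda>x. L x z))) (x, y) = indicator {y} z * L x y" for z
  proof (cases "z = y")
    case True
    then show ?thesis
      using pmf_map_inj'[of "\<lambda>x. (x, y)" "embed_pmf (\<lambda>x. L x y)" x] assms
      by (simp add: pmf_embed_pmf_nat inj_def)
  next
    case False
    then have "(x, y) \<notin> set_pmf (map_pmf (\<lambda>x. (x, z)) (embed_pmf (\<lambda>x. L x z)))" by auto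
    then have "pmf (map_pmf (\<lambda>x. (x, z)) (embed_pmf (\<lambda>x. L x z))) (x, y) = 0"
      by (simp only: set_pmf_iff not_not)
    then show ?thesis using False by simp
  qed
  then show "pmf ?J (x, y) = f y * L x y"
    using assms by (simp add: pmf_bind measure_pmf_single pmf_embed_pmf_nat)
qed

lemma measure_snd_eq:
  fixes f :: "'a \<Rightarrow> real"
  assumes J: "\<And>x y. pmf J (x, y) = f y * L x y" and L: "\<And>y. (\<lambda>x :: nat. L x y) sums 1"
  shows "measure J {v. snd v = y} = f y"
proof -
  have "(\<lambda>x. measure J {(x, y)}) sums measure J (\<Union>x. {(x, y)})"
    by (rule measure_pmf.finite_measure_UNION) (auto simp: disjoint_family_on_def)
  also have "(\<Union>x. {(x, y)}) = {v. snd v = y}" by auto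
  finally have "(\<lambda>x. f y * L x y) sums measure J {v. snd v = y}"
    by (simp add: measure_pmf_single J)
  from sums_unique2[OF this sums_mult[OF L, of "f y"]] show ?thesis by simp
qed

lemma measure_fst_eq:
  fixes f :: "'a \<Rightarrow> real"
  assumes J: "\<And>x y. pmf J (x, y) = f x * L y x" and L: "\<And>x. (\<lambda>y :: nat. L y x) sums 1"
  shows "measure J {v. fst v = x} = f x"
proof -
  have "pmf (map_pmf prod.swap J) (y, x) = f x * L y x" for x y
    using pmf_map_inj'[of prod.swap J "(x, y)"] J by simp
  from measure_snd_eq[OF this L] show ?thesis by (simp add: vimage_def)
qed

text \<open>The weight in \<open>y\<close> is chosen so that its Pochhammer symbol cancels the
  denominator of the beta moments. For \<open>0 < \<theta> < 1\<close> the right side is the mass at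
  \<open>(x, y)\<close> of \<open>(U + V', U + V)\<close>, with \<open>U\<close>, \<open>V\<close>,
  \<open>V'\<close> independent negative binomial of parameters \<open>a\<close>, \<open>b\<close>,
  \<open>b'\<close>; note that \<open>x + y - i = i + (y - i) + (x - i)\<close>.\<close>

lemma beta_neg_binomial_joint_mass:
  assumes "prob_space M" and rp: "random_coefficient_part M p Z \<epsilon>"
    and pos: "0 < a" "0 < b" "0 < b'"
    and p: "beta_distributed M p a b" and e: "neg_binomial_distributed M \<epsilon> b' \<theta>"
  shows "neg_binomial_mass (a + b) \<theta> y * \<P>(\<omega> in M. thinned_sum Z \<epsilon> y \<omega> = x)
    = \<theta> powr (a + b + b') * (\<Sum>i\<le>min x y. pochhammer a i / fact i * (pochhammer b (y - i) / fact (y - i))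
        * (pochhammer b' (x - i) / fact (x - i)) * (1 - \<theta>) ^ (x + y - i))"
proof -
  have eq: "neg_binomial_mass (a + b) \<theta> y * (real (y choose i)
      * (pochhammer a i * pochhammer b (y - i) / pochhammer (a + b) (i + (y - i))) * neg_binomial_mass b' \<theta> (x - i))
    = \<theta> powr (a + b + b') * (pochhammer a i / fact i * (pochhammer b (y - i) / fact (y - i))
        * (pochhammer b' (x - i) / fact (x - i)) * (1 - \<theta>) ^ (x + y - i))"
    if "i \<le> min x y" for i
  proof -
    have 1: "(1 - \<theta>) ^ (x + y - i) = (1 - \<theta>) ^ y * (1 - \<theta>) ^ (x - i)"
      using that by (simp add: add.commute flip: power_add)
    have 2: "\<theta> powr (a + b + b') = \<theta> powr (a + b) * \<theta> powr b'"
      by (simp add: powr_add)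
    have 3: "real (y choose i) = fact y / (fact i * fact (y - i))"
      using that by (simp add: binomial_fact)
    have "pochhammer (a + b) y \<noteq> 0" "i + (y - i) = y"
      using pos pochhammer_pos[of "a + b" y] that by auto
    then show ?thesis
      unfolding 1 2 3 using pos by (simp add: neg_binomial_mass_pochhammer mult_ac)
  qed
  show ?thesis
    unfolding thinned_sum_prob[OF assms(1) rp] sum_distrib_left beta_distributed_moment[OF pos(1,2) p]
      e[unfolded neg_binomial_distributed_def, rule_format]
    by (rule sum.cong) (use eq in auto)
qed

lemma joint_law_if_beta_neg_binomial:
  assumes "prob_space M"
    and rp: "random_coefficient_part M p Z \<epsilon>" and rq: "random_coefficient_part M q W \<eta>"
    and pos: "0 < \<alpha>" "0 < \<beta>\<^sub>1" "0 < \<beta>\<^sub>2" "0 < \<theta>" "\<theta> < 1"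
    and p: "beta_distributed M p \<alpha> \<beta>\<^sub>1" and q: "beta_distributed M q \<alpha> \<beta>\<^sub>2"
    and e: "neg_binomial_distributed M \<epsilon> \<beta>\<^sub>2 \<theta>" and h: "neg_binomial_distributed M \<eta> \<beta>\<^sub>1 \<theta>"
  shows "\<exists>J. model_joint_law M Z \<epsilon> W \<eta> J \<and> set_pmf J = UNIV"
proof -
  interpret prob_space M by fact
  define L where "L x y = \<P>(\<omega> in M. thinned_sum Z \<epsilon> y \<omega> = x)" for x y
  define K where "K y x = \<P>(\<omega> in M. thinned_sum W \<eta> x \<omega> = y)" for x y
  have thinned_sum_measurable: "thinned_sum Z' \<epsilon>' n \<in> measurable M (count_space UNIV)"
    if "random_coefficient_part M p' Z' \<epsilon>'" for p' :: "'a \<Rightarrow> real" and Z' \<epsilon>' n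
  proof -
    have [measurable]: "\<And>i. Z' i \<in> measurable M (count_space UNIV)" "\<epsilon>' \<in> measurable M (count_space UNIV)"
      using that by (auto simp: random_coefficient_part_def cond_iid_bernoulli_def)
    show ?thesis unfolding thinned_sum_def[abs_def] by measurable
  qed
  have L: "(\<lambda>x. L x y) sums 1" and K: "(\<lambda>y. K y x) sums 1" for x y
    unfolding L_def K_def using thinned_sum_measurable[OF rp] thinned_sum_measurable[OF rq]
    by (auto intro: prob_nat_sums_1)
  \<comment> \<open>These are the intended marginals of the second and of the first
    coordinate.\<close>
  let ?fY = "neg_binomial_mass (\<alpha> + \<beta>\<^sub>1) \<theta>" and ?fX = "neg_binomial_mass (\<alpha> + \<beta>\<^sub>2) \<theta>"
  have "0 \<le> ?fY y" for y
    by (rule less_imp_le, rule neg_binomial_mass_pos) (use pos in auto)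
  moreover have "?fY sums 1"
    by (rule neg_binomial_mass_sums) (use pos in auto)
  moreover have "0 \<le> L x y" for x y by (simp add: L_def)
  ultimately obtain J where J: "\<And>x y. pmf J (x, y) = ?fY y * L x y"
    using exists_joint_pmf[of ?fY L] L by blast
  have mass: "?fY y * L x y = \<theta> powr (\<alpha> + \<beta>\<^sub>1 + \<beta>\<^sub>2) * (\<Sum>i\<le>min x y. pochhammer \<alpha> i / fact i * (pochhammer \<beta>\<^sub>1 (y - i) / fact (y - i))
        * (pochhammer \<beta>\<^sub>2 (x - i) / fact (x - i)) * (1 - \<theta>) ^ (x + y - i))" for x y
    unfolding L_def by (rule beta_neg_binomial_joint_mass[OF assms(1) rp pos(1,2,3) p e])
  \<comment> \<open>The joint mass computed from \<open>q\<close> and \<open>\<eta>\<close> is the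
    same sum, by its symmetry under exchanging \<open>x\<close> with \<open>y\<close> and
    \<open>\<beta>\<^sub>1\<close> with \<open>\<beta>\<^sub>2\<close>.\<close>
  have "?fX x * K y x = ?fY y * L x y" for x y
    unfolding mass unfolding K_def beta_neg_binomial_joint_mass[OF assms(1) rq pos(1,3,2) q h]
    by (simp add: min.commute add_ac mult_ac)
  then have J': "pmf J (x, y) = ?fX x * K y x" for x y
    using J by simp
  have "0 < pmf J (x, y)" for x y
    unfolding J mass using pos
    by (intro mult_pos_pos sum_pos) (auto intro!: mult_pos_pos divide_pos_pos pochhammer_pos)
  then have full: "set_pmf J = UNIV"
    by (auto simp: set_pmf_iff) (metis less_irrefl)
  have "model_joint_law M Z \<epsilon> W \<eta> J"
    unfolding model_joint_law_iff[OF full]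
    using measure_snd_eq[of J ?fY L, OF J L] measure_fst_eq[of J ?fX K, OF J' K] J J'
    by (simp add: L_def K_def)
  with full show ?thesis by blast
qed

theorem theorem4:
  fixes M :: "'a measure"
    and p q :: "'a \<Rightarrow> real"
    and Z W :: "nat \<Rightarrow> 'a \<Rightarrow> bool"
    and \<epsilon> \<eta> :: "'a \<Rightarrow> nat"
  assumes "prob_space M"
    and "random_coefficient_part M p Z \<epsilon>"
    and "random_coefficient_part M q W \<eta>"
    and "\<not> (ae_constant M p \<and> ae_constant M q)"
  shows "(\<exists>J. model_joint_law M Z \<epsilon> W \<eta> J \<and> set_pmf J = UNIV) \<longleftrightarrow>
         (\<exists>\<alpha> \<beta>\<^sub>1 \<beta>\<^sub>2 \<theta>. 0 < \<alpha> \<and> 0 < \<beta>\<^sub>1 \<and> 0 < \<beta>\<^sub>2 \<and> 0 < \<theta> \<and> \<theta> < 1 \<and>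
            beta_distributed M p \<alpha> \<beta>\<^sub>1 \<and> beta_distributed M q \<alpha> \<beta>\<^sub>2 \<and>
            neg_binomial_distributed M \<epsilon> \<beta>\<^sub>2 \<theta> \<and> neg_binomial_distributed M \<eta> \<beta>\<^sub>1 \<theta>)"
  using beta_neg_binomial_if_joint_law[OF assms] joint_law_if_beta_neg_binomial[OF assms(1-3)] by blast

end
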